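(* There is a positive constant $C$ such that, if $\mu$ is the equilibrium measure of a Borel subset of $(\partial T)^2$ and $\lambda\ge1$, one has $$\mathrm{Cap}\big(\{\zeta\in(\partial T)^2:\ \mathbb{V}^\mu(\zeta)>\lambda\}\big)\le C\,\frac{\|\mathbb{I}^*\mu\|^2_{\ell^2(T^2)}}{\lambda^3}.$$
   Context: $T$ is (the vertex set of) the infinite rooted binary tree with root $o$; $\partial T$ is the set of infinite descending sequences $\omega=(\omega^j)_{j\ge0}$, $\omega^0=o$, $\omega^{j+1}$ a child of $\omega^j$; $\overline{T}=T\cup\partial T$. For $\alpha,\beta\in T$, $\alpha\le\beta$ means that $\beta$ lies on the path from $o$ to $\alpha$; also $\omega\le\omega^j$ for all $j$ and $\omega\le\omega$ when $\omega\in\partial T$. $\overline{T}$ carries its compact metrizable topology given by the metric $\delta_0(\zeta,\xi)=2^{-d(\zeta\wedge\xi)}-\frac12(2^{-d(\zeta)}+2^{-d(\xi)})$, where $d(\zeta\wedge\xi)\in[1,\infty]$ is the number of common ancestors in $T$ of $\zeta,\xi$ (a vertex is its own ancestor) and $d(\zeta)=d(\zeta\wedge\zeta)$. $T^2=T\times T$, $\overline{T}^2=\overline{T}\times\overline{T}$, $(\partial T)^2=\partial T\times\partial T$, with product order and topology. For $f:T^2\to[0,\infty)$, $\mathbb{I}f(\alpha)=\sum_{\gamma\in T^2,\gamma\ge\alpha}f(\gamma)$, $\alpha\in\overline{T}^2$. For a Borel measure $\mu\ge0$ on $\overline{T}^2$: $\mathbb{I}^*\mu(\beta)=\mu(\{\alpha\in\overline{T}^2:\alpha\le\beta\})$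 for $\beta\in T^2$, and $\mathbb{V}^\mu=\mathbb{I}(\mathbb{I}^*\mu)$. Capacity: $\mathrm{Cap}(E)=\inf\{\|f\|^2_{\ell^2(T^2)}:f\ge0,\ \mathbb{I}f\ge1\text{ on }E\}$. For a Borel set $E\subseteq\overline{T}^2$ the equilibrium measure $\mu_E$ is the unique Borel measure $\mu_E\ge0$ on $\overline{T}^2$ such that $\mathbb{I}^*\mu_E$ is the extremal function for $\mathrm{Cap}(E)$, i.e. the unique element of minimal norm in the $\ell^2(T^2)$-closure of $\{f\ge0:\mathbb{I}f\ge1\text{ on }E\}$; thus $\mathrm{Cap}(E)=\|\mathbb{I}^*\mu_E\|^2_{\ell^2(T^2)}$. *)

theory Defs
  imports "HOL-Analysis.Analysis" "HOL-Library.Sublist"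
begin

section \<open>The rooted binary tree and its closure\<close>

text \<open>
  A vertex is its address, the list of left/right choices read from the root; the root is \<open>[]\<close>, the
  children of \<open>v\<close> are \<open>v @ [False]\<close> and \<open>v @ [True]\<close>, and the vertices on the path from the root to
  \<open>v\<close> are the prefixes of \<open>v\<close>. An infinite descending sequence of vertices starting at the root
  corresponds to the sequence \<open>w\<close> of its choices; its \<open>j\<close>-th vertex is \<open>ray_vertex w j\<close>.
\<close>

type_synonym vertex = "bool list"

datatype tbar = Vert vertex | Bdry "nat \<Rightarrow> bool"

definition ray_vertex :: "(nat \<Rightarrow> bool) \<Rightarrow> nat \<Rightarrow> vertex" where
  "ray_vertex w j = map w [0..<j]"

lemma length_ray_vertex [simp]: "length (ray_vertex w j) = j"
  by (simp add: ray_vertex_def)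

lemma ray_vertex_nth: "i < j \<Longrightarrow> ray_vertex w j ! i = w i"
  by (simp add: ray_vertex_def)

lemma prefix_ray_vertex_iff:
  "prefix u (ray_vertex w j) \<longleftrightarrow> (\<exists>i\<le>j. u = ray_vertex w i)"
proof
  assume "prefix u (ray_vertex w j)"
  then have le: "length u \<le> j" and u: "u = take (length u) (ray_vertex w j)"
    using prefix_length_le[of u "ray_vertex w j"] by (auto simp: prefix_def)
  have "u = ray_vertex w (length u)"
    using u le by (simp add: ray_vertex_def take_map)
  then show "\<exists>i\<le>j. u = ray_vertex w i" using le by blast
next
  assume "\<exists>i\<le>j. u = ray_vertex w i"
  then obtain i where i: "i \<le> j" "u = ray_vertex w i" by blast
  then have "u = take i (ray_vertex w j)"
    by (simp add: ray_vertex_def take_map)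
  then show "prefix u (ray_vertex w j)" by (metis take_is_prefix)
qed

lemma ray_vertex_inj: "(\<And>j. ray_vertex w j = ray_vertex w' j) \<Longrightarrow> w = w'"
  by (rule ext) (metis lessI ray_vertex_nth)

text \<open>The order is the one in which smaller elements are the descendants: the root is the greatest
  element, and \<open>\<zeta> \<le> Vert v\<close> says that \<open>v\<close> is an ancestor of \<open>\<zeta>\<close>.\<close>

instantiation tbar :: order
begin

fun less_eq_tbar :: "tbar \<Rightarrow> tbar \<Rightarrow> bool" where
  "Vert u \<le> Vert v \<longleftrightarrow> prefix v u"
| "Bdry w \<le> Vert v \<longleftrightarrow> (\<exists>j. v = ray_vertex w j)"
| "Bdry w \<le> Bdry w' \<longleftrightarrow> w = w'"
| "Vert u \<le> Bdry w \<longleftrightarrow> False"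

definition less_tbar :: "tbar \<Rightarrow> tbar \<Rightarrow> bool" where
  "less_tbar \<zeta> \<xi> \<longleftrightarrow> \<zeta> \<le> \<xi> \<and> \<not> \<xi> \<le> \<zeta>"

instance
proof
  fix x y z :: tbar
  show "x < y \<longleftrightarrow> x \<le> y \<and> \<not> y \<le> x" by (rule less_tbar_def)
  show "x \<le> x" by (cases x) auto
  show "x \<le> z" if "x \<le> y" "y \<le> z"
    using that by (cases x; cases y; cases z) (auto simp: prefix_ray_vertex_iff dest: prefix_order.trans)
  show "x = y" if "x \<le> y" "y \<le> x"
    using that by (cases x; cases y) auto
qed

end

definition ancestors :: "tbar \<Rightarrow> vertex set" where
  "ancestors \<zeta> = {v. \<zeta> \<le> Vert v}"

definition meet_depth :: "tbar \<Rightarrow> tbar \<Rightarrow> enat" where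
  "meet_depth \<zeta> \<xi> =
    (if finite (ancestors \<zeta> \<inter> ancestors \<xi>) then enat (card (ancestors \<zeta> \<inter> ancestors \<xi>)) else \<infinity>)"

definition depth :: "tbar \<Rightarrow> enat" where
  "depth \<zeta> = meet_depth \<zeta> \<zeta>"

fun half_pow :: "enat \<Rightarrow> real" where
  "half_pow (enat n) = (1/2) ^ n"
| "half_pow \<infinity> = 0"

lemma half_pow_nonneg: "0 \<le> half_pow n"
  by (cases n) auto

lemma half_pow_antimono: "m \<le> n \<Longrightarrow> half_pow n \<le> half_pow m"
  by (cases m; cases n) (auto intro: power_decreasing)

lemma half_pow_inject: "half_pow m = half_pow n \<Longrightarrow> m = n"
  by (cases m; cases n) (auto simp: power_inject_exp' power_one_over)

lemma ancestors_chain: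
  assumes "u \<in> ancestors \<zeta>" "v \<in> ancestors \<zeta>"
  shows "prefix u v \<or> prefix v u"
proof (cases \<zeta>)
  case (Vert x)
  with assms show ?thesis using prefix_same_cases[of u x v] by (auto simp: ancestors_def)
next
  case (Bdry w)
  with assms obtain i j where "u = ray_vertex w i" "v = ray_vertex w j"
    by (auto simp: ancestors_def)
  then show ?thesis
    using prefix_ray_vertex_iff nle_le[of i j] by blast
qed

lemma ancestors_prefix_closed:
  assumes "v \<in> ancestors \<zeta>" "prefix u v"
  shows "u \<in> ancestors \<zeta>"
  using assms order_trans[of \<zeta> "Vert v" "Vert u"] by (auto simp: ancestors_def)

lemma ancestors_inject:
  assumes "ancestors \<zeta> = ancestors \<xi>"
  shows "\<zeta> = \<xi>"
proof -
  have eq: "\<zeta> \<le> Vert v \<longleftrightarrow> \<xi> \<le> Vert v" for v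
    using assms by (auto simp: ancestors_def)
  have not_bdry_vert: False if "\<And>v. Bdry w \<le> Vert v \<longleftrightarrow> Vert x \<le> Vert v" for w x
  proof -
    have "Bdry w \<le> Vert (ray_vertex w (Suc (length x)))" by auto
    then have "prefix (ray_vertex w (Suc (length x))) x" using that by simp
    then show False by (auto dest: prefix_length_le)
  qed
  show ?thesis
  proof (cases \<zeta>; cases \<xi>)
    fix x y assume "\<zeta> = Vert x" "\<xi> = Vert y"
    then show ?thesis using eq[of x] eq[of y] by auto
  next
    fix x w assume "\<zeta> = Vert x" "\<xi> = Bdry w"
    then show ?thesis using eq not_bdry_vert[of w x] by simp
  next
    fix x w assume "\<zeta> = Bdry w" "\<xi> = Vert x"
    then show ?thesis using eq not_bdry_vert[of w x] by simp
  next
    fix w w' assume wb: "\<zeta> = Bdry w" "\<xi> = Bdry w'"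
    have "ray_vertex w j = ray_vertex w' j" for j
    proof -
      have "\<xi> \<le> Vert (ray_vertex w j)" using eq wb by auto
      then obtain i where "ray_vertex w j = ray_vertex w' i" using wb by auto
      moreover from this have "j = i" by (metis length_ray_vertex)
      ultimately show ?thesis by simp
    qed
    then show ?thesis using wb ray_vertex_inj by blast
  qed
qed

lemma meet_depth_commute: "meet_depth x y = meet_depth y x"
  by (simp add: meet_depth_def Int_commute)

lemma meet_depth_mono:
  assumes "ancestors x \<inter> ancestors y \<subseteq> ancestors x' \<inter> ancestors y'"
  shows "meet_depth x y \<le> meet_depth x' y'"
  using assms finite_subset[OF assms] card_mono[OF _ assms] by (auto simp: meet_depth_def)

lemma meet_depth_le: "meet_depth x y \<le> depth x" "meet_depth x y \<le> depth y"
  unfolding depth_def by (auto intro: meet_depth_mono)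

lemma meet_depth_ultra: "meet_depth x y \<le> meet_depth x z \<or> meet_depth y z \<le> meet_depth x z"
proof -
  let ?A = "ancestors x \<inter> ancestors y" and ?B = "ancestors y \<inter> ancestors z"
  have "?A \<subseteq> ?B \<or> ?B \<subseteq> ?A"
  proof (rule ccontr)
    assume "\<not> ?thesis"
    then obtain u v where uv: "u \<in> ?A" "u \<notin> ?B" "v \<in> ?B" "v \<notin> ?A" by blast
    then have "prefix u v \<or> prefix v u" using ancestors_chain by blast
    then show False using uv ancestors_prefix_closed by blast
  qed
  then have "?A \<subseteq> ancestors x \<inter> ancestors z \<or> ?B \<subseteq> ancestors x \<inter> ancestors z" by blast
  then show ?thesis using meet_depth_mono by blast
qed

lemma ancestors_subset_if_depth_eq:
  assumes "meet_depth x y = depth x"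
  shows "ancestors x \<subseteq> ancestors y"
proof (cases "finite (ancestors x)")
  case True
  then have "card (ancestors x \<inter> ancestors y) = card (ancestors x)"
    using assms by (simp add: meet_depth_def depth_def)
  then have "ancestors x \<inter> ancestors y = ancestors x"
    using True by (intro card_subset_eq) auto
  then show ?thesis by blast
next
  case False
  then have inf: "infinite (ancestors x \<inter> ancestors y)"
    using assms by (auto simp: meet_depth_def depth_def split: if_splits)
  show ?thesis
  proof
    fix u assume u: "u \<in> ancestors x"
    have "finite {v. prefix v u}" by (metis finite_set set_prefixes_eq)
    then obtain v where v: "v \<in> ancestors x" "v \<in> ancestors y" "\<not> prefix v u"
      using inf finite_subset[of "ancestors x \<inter> ancestors y" "{v. prefix v u}"] by blast
    then have "prefix u v" using ancestors_chain u by blast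
    then show "u \<in> ancestors y" using v ancestors_prefix_closed by blast
  qed
qed

instantiation tbar :: metric_space
begin

definition dist_tbar :: "tbar \<Rightarrow> tbar \<Rightarrow> real" where
  "dist_tbar \<zeta> \<xi> = half_pow (meet_depth \<zeta> \<xi>) - 1/2 * (half_pow (depth \<zeta>) + half_pow (depth \<xi>))"

definition uniformity_tbar :: "(tbar \<times> tbar) filter" where
  "uniformity_tbar = (INF e\<in>{0<..}. principal {(x, y). dist x y < e})"

definition open_tbar :: "tbar set \<Rightarrow> bool" where
  "open_tbar U \<longleftrightarrow> (\<forall>x\<in>U. \<forall>\<^sub>F (x', y) in uniformity. x' = x \<longrightarrow> y \<in> U)"

instance
proof
  fix x y z :: tbar and U :: "tbar set"
  show "(uniformity :: (tbar \<times> tbar) filter) = (INF e\<in>{0<..}. principal {(x, y). dist x y < e})"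
    by (rule uniformity_tbar_def)
  show "open U \<longleftrightarrow> (\<forall>x\<in>U. \<forall>\<^sub>F (x', y) in uniformity. x' = x \<longrightarrow> y \<in> U)"
    by (rule open_tbar_def)
  have hx: "half_pow (depth x) \<le> half_pow (meet_depth x y)"
    and hy: "half_pow (depth y) \<le> half_pow (meet_depth x y)"
    by (auto intro: half_pow_antimono meet_depth_le)
  show "dist x y = 0 \<longleftrightarrow> x = y"
  proof
    assume "x = y"
    then show "dist x y = 0" by (simp add: dist_tbar_def depth_def)
  next
    assume "dist x y = 0"
    then have "half_pow (meet_depth x y) = half_pow (depth x)"
      and "half_pow (meet_depth x y) = half_pow (depth y)"
      using hx hy by (auto simp: dist_tbar_def field_simps)
    then have "meet_depth x y = depth x" "meet_depth y x = depth y"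
      by (auto intro: half_pow_inject simp: meet_depth_commute)
    then have "ancestors x = ancestors y"
      using ancestors_subset_if_depth_eq by blast
    then show "x = y" by (rule ancestors_inject)
  qed
  have "half_pow (meet_depth x y) \<le> half_pow (meet_depth x z) + half_pow (meet_depth y z) - half_pow (depth z)"
  proof -
    have "half_pow (meet_depth x y) \<le> half_pow (meet_depth x z)
        \<or> half_pow (meet_depth x y) \<le> half_pow (meet_depth y z)"
      using meet_depth_ultra[of x z y] by (auto simp: meet_depth_commute intro: half_pow_antimono)
    moreover have "half_pow (depth z) \<le> half_pow (meet_depth x z)"
      and "half_pow (depth z) \<le> half_pow (meet_depth y z)"
      by (auto intro: half_pow_antimono meet_depth_le)
    ultimately show ?thesis by linarith
  qed
  then show "dist x y \<le> dist x z + dist y z"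
    by (simp add: dist_tbar_def field_simps)
qed

end


section \<open>Potentials and capacity on the bitree\<close>

text \<open>The closed bitree is the type \<open>tbar \<times> tbar\<close> with the library's product order and product
  topology; the bitree itself is embedded in it by \<open>vert2\<close>. Sums over vertices are integrals with
  respect to counting measure, so that divergent sums have value \<open>\<infinity>\<close>.\<close>

type_synonym bivertex = "vertex \<times> vertex"
type_synonym bitbar = "tbar \<times> tbar"

definition vert2 :: "bivertex \<Rightarrow> bitbar" where
  "vert2 = map_prod Vert Vert"

definition boundary2 :: "bitbar set" where
  "boundary2 = range Bdry \<times> range Bdry"

definition potential :: "(bivertex \<Rightarrow> ennreal) \<Rightarrow> bitbar \<Rightarrow> ennreal" where
  "potential f \<alpha> = (\<integral>\<^sup>+ \<gamma>. f \<gamma> \<partial>count_space {\<gamma>. \<alpha> \<le> vert2 \<gamma>})"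

definition copotential :: "bitbar measure \<Rightarrow> bivertex \<Rightarrow> ennreal" where
  "copotential \<mu> \<beta> = emeasure \<mu> {\<alpha>. \<alpha> \<le> vert2 \<beta>}"

definition V_potential :: "bitbar measure \<Rightarrow> bitbar \<Rightarrow> ennreal" where
  "V_potential \<mu> = potential (copotential \<mu>)"

definition ell2_norm_sq :: "(bivertex \<Rightarrow> ennreal) \<Rightarrow> ennreal" where
  "ell2_norm_sq f = (\<integral>\<^sup>+ \<gamma>. (f \<gamma>)\<^sup>2 \<partial>count_space UNIV)"

definition admissible :: "bitbar set \<Rightarrow> (bivertex \<Rightarrow> real) set" where
  "admissible E = {f. (\<forall>\<gamma>. 0 \<le> f \<gamma>) \<and> (\<forall>\<alpha>\<in>E. 1 \<le> potential (\<lambda>\<gamma>. ennreal (f \<gamma>)) \<alpha>)}"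

definition cap :: "bitbar set \<Rightarrow> ennreal" where
  "cap E = (INF f\<in>admissible E. ell2_norm_sq (\<lambda>\<gamma>. ennreal (f \<gamma>)))"

definition ell2_closure :: "(bivertex \<Rightarrow> real) set \<Rightarrow> (bivertex \<Rightarrow> real) set" where
  "ell2_closure F = {f. ell2_norm_sq (\<lambda>\<gamma>. ennreal \<bar>f \<gamma>\<bar>) < \<infinity> \<and>
     (\<forall>\<epsilon>>0. \<exists>g\<in>F. ell2_norm_sq (\<lambda>\<gamma>. ennreal \<bar>f \<gamma> - g \<gamma>\<bar>) < ennreal (\<epsilon>\<^sup>2))}"

definition extremal :: "bitbar set \<Rightarrow> (bivertex \<Rightarrow> real) \<Rightarrow> bool" where
  "extremal E f \<longleftrightarrow> f \<in> ell2_closure (admissible E) \<and>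
     (\<forall>g\<in>ell2_closure (admissible E).
        ell2_norm_sq (\<lambda>\<gamma>. ennreal \<bar>f \<gamma>\<bar>) \<le> ell2_norm_sq (\<lambda>\<gamma>. ennreal \<bar>g \<gamma>\<bar>))"

text \<open>Elements of the closure are pointwise nonnegative, so \<open>ennreal (f \<beta>)\<close> below truncates nothing;
  in particular the copotential of an equilibrium measure is finite.\<close>

definition equilibrium_measure :: "bitbar set \<Rightarrow> bitbar measure \<Rightarrow> bool" where
  "equilibrium_measure E \<mu> \<longleftrightarrow> sets \<mu> = sets borel \<and>
     (\<exists>f. extremal E f \<and> (\<forall>\<beta>. copotential \<mu> \<beta> = ennreal (f \<beta>)))"

end

theory Submission
  imports Defs
begin

text \<open>
  Let \<open>f\<close> be the copotential of the equilibrium measure and \<open>F = \<I> f\<close> its potential. The estimate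
  rests on two properties of \<open>f\<close>.

  First, \<open>f\<close> is superadditive in each variable: the mass of the descendants of a vertex is at least
  the sum of the masses of the descendants of its children (\<open>copotential_superadditive\<close>).
  Second, \<open>F \<le> 1\<close> wherever \<open>f > 0\<close> (\<open>extremal_potential_le_1\<close>): if \<open>F(\<alpha>) > 1\<close>, lowering \<open>f\<close> slightly
  at the single vertex \<open>\<alpha>\<close> would keep the potential at least \<open>1\<close> below \<open>\<alpha>\<close> and not change it
  elsewhere, so \<open>f\<close> would not have minimal norm. On a single tree this would give \<open>F \<le> 1\<close> everywhere,
  but on the bitree there is no such maximum principle, and the superlevel sets of \<open>F\<close> have to be
  estimated.

  Let \<open>R\<close> and \<open>C\<close> be the sums of \<open>f\<close> over the ancestors in the second and in the first variable
  alone. They are the discrete derivatives of \<open>F\<close> in the first and in the second variable, and \<open>f\<close> is the mixed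
  second derivative, so a discrete form of \<open>\<partial>\<^sub>1\<partial>\<^sub>2(F\<^sup>2) = 2 (f F + R C)\<close> gives
  \<open>F\<^sup>2 \<le> 2 \<I>(f F + R C) \<le> 2 \<I>(f + R C)\<close>; this is \<open>bihardy_power2_le\<close>. Hence
  \<open>\<phi> = 2 (f + R C) / \<lambda>\<^sup>2\<close> is admissible for \<open>{F > \<lambda>}\<close>.

  It remains to see that the norm of \<open>R C\<close> is at most twice that of \<open>f\<close> (\<open>sum_mixed_power2_le\<close>).
  Applying the one-variable product rule to \<open>C\<^sup>2\<close> and to \<open>R\<^sup>2\<close> turns the sum of \<open>R\<^sup>2 C\<^sup>2\<close> into a sum over
  rectangles. For a fixed corner \<open>(u, v)\<close> it splits into two sums over the descendants in one
  variable, and each of these is at most \<open>f(u, v)\<close>, because a superadditive function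
  \<open>h\<close> that lives where \<open>\<I> g \<le> 1\<close> has \<open>\<Sum>\<^bsub>w \<le> v\<^esub> h(w) g(w) \<le> h(v)\<close> (\<open>sum_below_le\<close>).
  The outcome is the bound \<open>40 \<lambda>\<^sup>-\<^sup>4 \<parallel>f\<parallel>\<^sup>2\<close>, which is at most \<open>40 \<lambda>\<^sup>-\<^sup>3 \<parallel>f\<parallel>\<^sup>2\<close> for \<open>\<lambda> \<ge> 1\<close>.
\<close>

section \<open>Sums along and below the vertices of one tree\<close>

definition hardy :: "(vertex \<Rightarrow> real) \<Rightarrow> vertex \<Rightarrow> real" where
  "hardy g v = (\<Sum>u | prefix u v. g u)"

lemma finite_prefixes: "finite {u. prefix u v}"
  by (metis finite_set set_prefixes_eq)

lemma hardy_Nil [simp]: "hardy g [] = g []"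
  by (simp add: hardy_def)

lemma hardy_snoc: "hardy g (v @ [x]) = hardy g v + g (v @ [x])"
proof -
  have "{u. prefix u (v @ [x])} = insert (v @ [x]) {u. prefix u v}" by auto
  moreover have "v @ [x] \<notin> {u. prefix u v}" by (auto dest: prefix_length_le)
  ultimately show ?thesis unfolding hardy_def by (simp add: finite_prefixes)
qed

lemma hardy_nonneg: "(\<And>u. 0 \<le> g u) \<Longrightarrow> 0 \<le> hardy g v"
  by (simp add: hardy_def sum_nonneg)

lemma hardy_mono: "(\<And>u. prefix u v \<Longrightarrow> g u \<le> h u) \<Longrightarrow> hardy g v \<le> hardy h v"
  unfolding hardy_def by (rule sum_mono) simp

lemma hardy_cmult: "hardy (\<lambda>u. c * g u) v = c * hardy g v"
  by (simp add: hardy_def sum_distrib_left)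

lemma hardy_swap: "hardy (\<lambda>u. hardy (f u) b) a = hardy (\<lambda>v. hardy (\<lambda>u. f u v) a) b"
  unfolding hardy_def by (rule sum.swap)

text \<open>A discrete product rule: \<open>p\<close> and \<open>q\<close> are the increments of \<open>hardy p\<close> and \<open>hardy q\<close> along the path
  from the root, and the product \<open>p u * q u\<close> of the increments, counted twice on the right and once
  on the left, is what makes it an inequality.\<close>

lemma hardy_product_le:
  assumes "\<And>u. 0 \<le> p u" "\<And>u. 0 \<le> q u"
  shows "hardy p v * hardy q v \<le> hardy (\<lambda>u. p u * hardy q u + hardy p u * q u) v"
proof (induction v rule: rev_induct)
  case Nil
  then show ?case using assms by simp
next
  case (snoc x v)
  have "0 \<le> p (v @ [x]) * q (v @ [x])" using assms by simp
  then show ?case using snoc.IH by (simp add: hardy_snoc algebra_simps)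
qed

lemma hardy_power2_le:
  assumes "\<And>u. 0 \<le> p u"
  shows "(hardy p v)\<^sup>2 \<le> 2 * hardy (\<lambda>u. p u * hardy p u) v"
  using hardy_product_le[of p p v] assms
  by (simp add: power2_eq_square hardy_cmult[symmetric] algebra_simps)

definition superadditive :: "(vertex \<Rightarrow> real) \<Rightarrow> bool" where
  "superadditive h \<longleftrightarrow> (\<forall>v. h (v @ [False]) + h (v @ [True]) \<le> h v)"

lemma finite_length_le: "finite {w :: vertex. length w \<le> n}"
  using finite_lists_length_le[of "UNIV :: bool set" n] by simp

lemma descendants_Suc:
  "{w :: vertex. length w \<le> Suc n} =
     insert [] ((#) False ` {w. length w \<le> n} \<union> (#) True ` {w. length w \<le> n})"
proof (intro set_eqI iffI)
  fix w :: vertex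
  assume "w \<in> {w. length w \<le> Suc n}"
  then show "w \<in> insert [] ((#) False ` {w. length w \<le> n} \<union> (#) True ` {w. length w \<le> n})"
    by (cases w; cases "hd w") auto
qed auto

text \<open>The descendants of \<open>v\<close> are \<open>v\<close> itself and those of its two children.\<close>

lemma sum_descendants_Suc:
  fixes k :: "vertex \<Rightarrow> real"
  shows "(\<Sum>w | length w \<le> Suc n. k (v @ w)) =
    k v + (\<Sum>w | length w \<le> n. k ((v @ [False]) @ w)) + (\<Sum>w | length w \<le> n. k ((v @ [True]) @ w))"
proof -
  have "(\<Sum>w\<in>(#) x ` {w. length w \<le> n}. k (v @ w)) = (\<Sum>w | length w \<le> n. k ((v @ [x]) @ w))" for x
    by (subst sum.reindex) auto
  moreover have "(#) False ` {w. length w \<le> n} \<inter> (#) True ` {w. length w \<le> n} = {}" by auto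
  ultimately show ?thesis unfolding descendants_Suc
    by (subst sum.insert) (auto simp: finite_length_le sum.union_disjoint)
qed

text \<open>The sum over the descendants of \<open>v\<close> only uses what the path down to the parent of \<open>v\<close> leaves of
  the bound \<open>\<delta>\<close>, namely \<open>\<delta> - (hardy g v - g v)\<close>. With this factor the estimate passes from the
  children of \<open>v\<close>, where it reads \<open>\<delta> - hardy g v\<close> for both, to \<open>v\<close> by superadditivity.\<close>

lemma sum_below_le_aux:
  assumes sup: "superadditive h" and h: "\<And>v. 0 \<le> h v" and g: "\<And>v. 0 \<le> g v"
    and bd: "\<And>v. h v > 0 \<Longrightarrow> hardy g v \<le> \<delta>"
  shows "(\<Sum>w | length w \<le> n. h (v @ w) * g (v @ w)) \<le> (\<delta> - hardy g v + g v) * h v"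
proof (induction n arbitrary: v)
  case 0
  have "hardy g v * h v \<le> \<delta> * h v"
    using bd[of v] h[of v] by (cases "h v = 0") (auto intro!: mult_right_mono)
  then show ?case by (simp add: algebra_simps)
next
  case (Suc n)
  let ?S = "\<lambda>v. \<Sum>w | length w \<le> n. h (v @ w) * g (v @ w)"
  have child: "?S (v @ [x]) \<le> (\<delta> - hardy g v) * h (v @ [x])" for x
    using Suc.IH[of "v @ [x]"] by (simp add: hardy_snoc)
  have hv: "h (v @ [False]) + h (v @ [True]) \<le> h v"
    using sup by (simp add: superadditive_def)
  have "(\<delta> - hardy g v) * (h (v @ [False]) + h (v @ [True])) \<le> (\<delta> - hardy g v) * h v"
    \<comment> \<open>The factor may be negative where \<open>h v = 0\<close>, but then \<open>h\<close> vanishes at both children.\<close>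
  proof (cases "h v = 0")
    case True
    with hv h[of "v @ [False]"] h[of "v @ [True]"]
    have "h (v @ [False]) = 0" "h (v @ [True]) = 0" by auto
    then show ?thesis using True by simp
  next
    case False
    then have "hardy g v \<le> \<delta>" using bd h by (simp add: less_le)
    then show ?thesis using hv by (intro mult_left_mono) auto
  qed
  moreover have "(\<Sum>w | length w \<le> Suc n. h (v @ w) * g (v @ w))
      = h v * g v + ?S (v @ [False]) + ?S (v @ [True])"
    by (rule sum_descendants_Suc)
  ultimately show ?case using child[of False] child[of True] by (simp add: algebra_simps)
qed

text \<open>If \<open>h v\<close> is the mass that a measure gives to the boundary points below \<open>v\<close>, then the left side is
  the integral of the sums of \<open>g\<close> along the paths starting at \<open>v\<close>, which are at most \<open>\<delta>\<close> almost everywhere.\<close>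

lemma sum_below_le:
  assumes "superadditive h" "\<And>v. 0 \<le> h v" "\<And>v. 0 \<le> g v" "\<And>v. h v > 0 \<Longrightarrow> hardy g v \<le> \<delta>"
  shows "(\<Sum>w | length w \<le> n \<and> prefix v w. h w * g w) \<le> \<delta> * h v"
proof -
  have inj: "inj_on ((@) v) X" for X by (auto simp: inj_on_def)
  have "(\<Sum>w | length w \<le> n \<and> prefix v w. h w * g w)
      \<le> (\<Sum>w\<in>(@) v ` {w. length w \<le> n}. h w * g w)"
    by (rule sum_mono2) (auto simp: finite_length_le prefix_def assms)
  also have "\<dots> = (\<Sum>w | length w \<le> n. h (v @ w) * g (v @ w))"
    by (simp add: sum.reindex[OF inj])
  also have "\<dots> \<le> (\<delta> - hardy g v + g v) * h v"
    by (rule sum_below_le_aux) (use assms in auto)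
  also have "\<dots> \<le> \<delta> * h v"
  proof -
    have "g v \<le> hardy g v"
      unfolding hardy_def using assms(3)
      by (intro member_le_sum) (auto simp: finite_prefixes)
    then show ?thesis using assms(2) by (intro mult_right_mono) auto
  qed
  finally show ?thesis .
qed


section \<open>Two estimates on the bitree\<close>

definition row_sum :: "(vertex \<Rightarrow> vertex \<Rightarrow> real) \<Rightarrow> vertex \<Rightarrow> vertex \<Rightarrow> real" where
  "row_sum f a b = hardy (f a) b"

definition col_sum :: "(vertex \<Rightarrow> vertex \<Rightarrow> real) \<Rightarrow> vertex \<Rightarrow> vertex \<Rightarrow> real" where
  "col_sum f a b = hardy (\<lambda>u. f u b) a"

definition bihardy :: "(vertex \<Rightarrow> vertex \<Rightarrow> real) \<Rightarrow> vertex \<Rightarrow> vertex \<Rightarrow> real" where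
  "bihardy f a b = (\<Sum>u | prefix u a. \<Sum>v | prefix v b. f u v)"

lemma bihardy_eq_hardy_row_sum: "bihardy f a b = hardy (\<lambda>u. row_sum f u b) a"
  by (simp add: bihardy_def hardy_def row_sum_def)

lemma bihardy_eq_hardy_col_sum: "bihardy f a b = hardy (col_sum f a) b"
  unfolding bihardy_eq_hardy_row_sum row_sum_def
  by (subst hardy_swap) (simp add: col_sum_def[abs_def])

lemma bihardy_add: "bihardy (\<lambda>a b. f a b + g a b) a b = bihardy f a b + bihardy g a b"
  by (simp add: bihardy_def sum.distrib)

lemma bihardy_cmult: "bihardy (\<lambda>a b. c * f a b) a b = c * bihardy f a b"
  by (simp add: bihardy_def sum_distrib_left)

lemma bihardy_mono: "(\<And>a b. f a b \<le> g a b) \<Longrightarrow> bihardy f a b \<le> bihardy g a b"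
  by (simp add: bihardy_def sum_mono)

lemma row_sum_nonneg: "(\<And>a b. 0 \<le> f a b) \<Longrightarrow> 0 \<le> row_sum f a b"
  by (simp add: row_sum_def hardy_nonneg)

lemma col_sum_nonneg: "(\<And>a b. 0 \<le> f a b) \<Longrightarrow> 0 \<le> col_sum f a b"
  by (simp add: col_sum_def hardy_nonneg)

text \<open>The product of the two partial derivatives of \<open>bihardy f\<close>.\<close>

definition mixed :: "(vertex \<Rightarrow> vertex \<Rightarrow> real) \<Rightarrow> vertex \<Rightarrow> vertex \<Rightarrow> real" where
  "mixed f a b = row_sum f a b * col_sum f a b"

lemma mixed_nonneg: "(\<And>a b. 0 \<le> f a b) \<Longrightarrow> 0 \<le> mixed f a b"
  by (simp add: mixed_def row_sum_nonneg col_sum_nonneg)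

text \<open>Expand the square into a sum over pairs of ancestors. In each variable the two members of a pair
  are comparable. The pairs ordered alike in both variables give \<open>f * bihardy f\<close>, and those ordered
  oppositely are counted at the common lower corner of their rectangle by \<open>mixed f\<close>. The proof
  obtains this by using the product rule in one variable after the other.\<close>

lemma bihardy_power2_le:
  assumes f: "\<And>a b. 0 \<le> f a b"
  shows "(bihardy f a b)\<^sup>2 \<le> 2 * bihardy (\<lambda>a b. f a b * bihardy f a b + mixed f a b) a b"
proof -
  note nonneg = f row_sum_nonneg[of f, OF f] col_sum_nonneg[of f, OF f]
  have inner: "row_sum f u b * bihardy f u b
      \<le> hardy (\<lambda>v. f u v * bihardy f u v + mixed f u v) b" for u
    using hardy_product_le[of "f u" "col_sum f u" b] nonneg
    by (simp add: row_sum_def mixed_def bihardy_eq_hardy_col_sum)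
  have "(bihardy f a b)\<^sup>2 \<le> 2 * hardy (\<lambda>u. row_sum f u b * bihardy f u b) a"
    using hardy_power2_le[of "\<lambda>u. row_sum f u b" a] nonneg
    by (simp add: bihardy_eq_hardy_row_sum)
  also have "\<dots> \<le> 2 * hardy (\<lambda>u. hardy (\<lambda>v. f u v * bihardy f u v + mixed f u v) b) a"
    using inner by (simp add: hardy_mono)
  finally show ?thesis by (simp add: bihardy_def hardy_def)
qed

text \<open>A rectangle with lower corner \<open>(a, b)\<close> and upper corner \<open>(u, v)\<close> is chosen from either corner; seen
  from the upper one, the product \<open>X u b * Y a v\<close> separates the variables \<open>a\<close> and \<open>b\<close>.\<close>

lemma sum_product_rectangle_swap:
  fixes X Y :: "vertex \<Rightarrow> vertex \<Rightarrow> real" and n :: nat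
  defines "A \<equiv> {w :: vertex. length w \<le> n}"
  shows "(\<Sum>a\<in>A. \<Sum>b\<in>A. (\<Sum>u | prefix u a. X u b) * (\<Sum>v | prefix v b. Y a v))
    = (\<Sum>u\<in>A. \<Sum>v\<in>A. (\<Sum>b | length b \<le> n \<and> prefix v b. X u b)
                       * (\<Sum>a | length a \<le> n \<and> prefix u a. Y a v))"
proof -
  have fin: "finite A" by (simp add: A_def finite_length_le)
  have below: "{w. length w \<le> n \<and> prefix v w} = {w \<in> A. prefix v w}" for v by (auto simp: A_def)
  have above: "{u. prefix u a} = {u \<in> A. prefix u a}" if "a \<in> A" for a
    using that by (auto simp: A_def dest: prefix_length_le)
  have "(\<Sum>a\<in>A. \<Sum>b\<in>A. (\<Sum>u | prefix u a. X u b) * (\<Sum>v | prefix v b. Y a v))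
      = (\<Sum>a\<in>A. \<Sum>b\<in>A. \<Sum>u | u \<in> A \<and> prefix u a. \<Sum>v | v \<in> A \<and> prefix v b. X u b * Y a v)"
    by (intro sum.cong refl) (simp add: above[symmetric] sum_product)
  also have "\<dots> = (\<Sum>a\<in>A. \<Sum>u | u \<in> A \<and> prefix u a. \<Sum>b\<in>A. \<Sum>v | v \<in> A \<and> prefix v b. X u b * Y a v)"
    by (intro sum.cong refl sum.swap)
  also have "\<dots> = (\<Sum>u\<in>A. \<Sum>a | a \<in> A \<and> prefix u a. \<Sum>b\<in>A. \<Sum>v | v \<in> A \<and> prefix v b. X u b * Y a v)"
    by (rule sum.swap_restrict[OF fin fin])
  also have "\<dots> = (\<Sum>u\<in>A. \<Sum>a | a \<in> A \<and> prefix u a. \<Sum>v\<in>A. \<Sum>b | b \<in> A \<and> prefix v b. X u b * Y a v)"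
    by (intro sum.cong refl sum.swap_restrict[OF fin fin])
  also have "\<dots> = (\<Sum>u\<in>A. \<Sum>v\<in>A. \<Sum>a | a \<in> A \<and> prefix u a. \<Sum>b | b \<in> A \<and> prefix v b. X u b * Y a v)"
    by (intro sum.cong refl sum.swap)
  also have "\<dots> = (\<Sum>u\<in>A. \<Sum>v\<in>A. \<Sum>b | b \<in> A \<and> prefix v b. \<Sum>a | a \<in> A \<and> prefix u a. X u b * Y a v)"
    by (intro sum.cong refl sum.swap)
  finally show ?thesis by (simp add: below sum_product)
qed

text \<open>The one-variable square bound is applied to the factor \<open>col_sum\<close> in the first variable and to
  \<open>row_sum\<close> in the second; \<open>sum_below_le\<close> is then applied in the other variable each time, where the
  sums of \<open>col_sum f u\<close> and of \<open>\<lambda>a. row_sum f a v\<close> along a path are values of \<open>bihardy f\<close>. The estimate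
  is made on the vertices of bounded generation, so that all sums are finite and real.\<close>

lemma sum_mixed_power2_le:
  fixes n :: nat
  assumes f: "\<And>a b. 0 \<le> f a b"
    and sup1: "\<And>b. superadditive (\<lambda>a. f a b)" and sup2: "\<And>a. superadditive (f a)"
    and bd: "\<And>a b. f a b > 0 \<Longrightarrow> bihardy f a b \<le> \<delta>"
  defines "A \<equiv> {w :: vertex. length w \<le> n}"
  shows "(\<Sum>a\<in>A. \<Sum>b\<in>A. (mixed f a b)\<^sup>2) \<le> 4 * \<delta>\<^sup>2 * (\<Sum>a\<in>A. \<Sum>b\<in>A. (f a b)\<^sup>2)"
proof -
  note nonneg = f row_sum_nonneg[of f, OF f] col_sum_nonneg[of f, OF f]
  let ?X = "\<lambda>u b. f u b * col_sum f u b" and ?Y = "\<lambda>a v. f a v * row_sum f a v"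
  have pointwise: "(mixed f a b)\<^sup>2
      \<le> 4 * ((\<Sum>u | prefix u a. ?X u b) * (\<Sum>v | prefix v b. ?Y a v))" for a b
  proof -
    have "(col_sum f a b)\<^sup>2 \<le> 2 * hardy (\<lambda>u. ?X u b) a"
      using hardy_power2_le[of "\<lambda>u. f u b" a] f by (simp add: col_sum_def)
    moreover have "(row_sum f a b)\<^sup>2 \<le> 2 * hardy (?Y a) b"
      using hardy_power2_le[of "f a" b] f by (simp add: row_sum_def)
    ultimately have "(col_sum f a b)\<^sup>2 * (row_sum f a b)\<^sup>2
        \<le> (2 * hardy (\<lambda>u. ?X u b) a) * (2 * hardy (?Y a) b)"
      using nonneg by (intro mult_mono) (auto intro!: hardy_nonneg)
    then show ?thesis by (simp add: mixed_def power_mult_distrib hardy_def algebra_simps)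
  qed
  have X: "(\<Sum>b | length b \<le> n \<and> prefix v b. ?X u b) \<le> \<delta> * f u v" for u v
    by (rule sum_below_le) (use nonneg sup2 bd in \<open>auto simp: bihardy_eq_hardy_col_sum\<close>)
  have Y: "(\<Sum>a | length a \<le> n \<and> prefix u a. ?Y a v) \<le> \<delta> * f u v" for u v
    by (rule sum_below_le[where h = "\<lambda>a. f a v" and g = "\<lambda>a. row_sum f a v"])
      (use nonneg sup1 bd in \<open>auto simp: bihardy_eq_hardy_row_sum\<close>)
  have "(\<Sum>a\<in>A. \<Sum>b\<in>A. (mixed f a b)\<^sup>2)
      \<le> 4 * (\<Sum>a\<in>A. \<Sum>b\<in>A. (\<Sum>u | prefix u a. ?X u b) * (\<Sum>v | prefix v b. ?Y a v))"
    unfolding sum_distrib_left[of 4 _ A] by (intro sum_mono pointwise)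
  also have "\<dots> = 4 * (\<Sum>u\<in>A. \<Sum>v\<in>A. (\<Sum>b | length b \<le> n \<and> prefix v b. ?X u b)
                       * (\<Sum>a | length a \<le> n \<and> prefix u a. ?Y a v))"
    unfolding A_def by (subst sum_product_rectangle_swap) simp
  also have "\<dots> \<le> 4 * (\<Sum>u\<in>A. \<Sum>v\<in>A. (\<delta> * f u v) * (\<delta> * f u v))"
  proof (intro mult_left_mono sum_mono mult_mono X Y)
    fix u v
    show "0 \<le> (\<Sum>a | length a \<le> n \<and> prefix u a. ?Y a v)"
      using nonneg by (auto intro!: sum_nonneg)
    then show "0 \<le> \<delta> * f u v" using Y[where u = u and v = v] by linarith
  qed simp
  finally show ?thesis
    by (simp add: sum_distrib_left power2_eq_square algebra_simps)
qed


section \<open>Passing between integrals and finite sums\<close>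

lemma nn_integral_count_space_incseq:
  assumes inc: "incseq B" and fin: "\<And>n. finite (B n)"
  shows "(\<integral>\<^sup>+ x. f x \<partial>count_space (\<Union>n. B n)) = (SUP n. \<Sum>x\<in>B n. f x)"
proof -
  have "(\<integral>\<^sup>+ x. f x \<partial>count_space (\<Union>n. B n))
      = (\<integral>\<^sup>+ x. (SUP n. f x * indicator (B n) x) \<partial>count_space UNIV)"
  proof (subst nn_integral_count_space_indicator, simp, rule nn_integral_cong)
    fix x
    have "(SUP n. f x * indicator (B n) x) = f x * (SUP n. indicator (B n) x)"
      by (rule SUP_mult_left_ennreal[symmetric])
    also have "(SUP n. indicator (B n) x :: ennreal) = indicator (\<Union>n. B n) x"
    proof (cases "x \<in> (\<Union>n. B n)")
      case True
      then obtain n where "x \<in> B n" by blast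
      then have "(1 :: ennreal) \<le> (SUP n. indicator (B n) x)"
        by (intro SUP_upper2[of n]) auto
      moreover have "(SUP n. indicator (B n) x) \<le> (1 :: ennreal)"
        by (intro SUP_least) (auto simp: indicator_def)
      ultimately have "(SUP n. indicator (B n) x) = (1 :: ennreal)" by (intro antisym)
      then show ?thesis using True by simp
    qed simp
    finally show "f x * indicator (\<Union>n. B n) x = (SUP n. f x * indicator (B n) x)" by simp
  qed
  also have "\<dots> = (SUP n. \<integral>\<^sup>+ x. f x * indicator (B n) x \<partial>count_space UNIV)"
    using inc by (intro nn_integral_monotone_convergence_SUP)
      (auto simp: incseq_def le_fun_def indicator_def)
  also have "\<dots> = (SUP n. \<Sum>x\<in>B n. f x)"
    using fin by (simp add: nn_integral_count_space_indicator[symmetric] nn_integral_count_space_finite)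
  finally show ?thesis .
qed

definition level2 :: "nat \<Rightarrow> bivertex set" where
  "level2 n = {w. length w \<le> n} \<times> {w. length w \<le> n}"

lemma nn_integral_bivertex:
  "(\<integral>\<^sup>+ \<gamma>. f \<gamma> \<partial>count_space UNIV) = (SUP n. \<Sum>\<gamma>\<in>level2 n. f \<gamma>)"
proof -
  have "\<gamma> \<in> (\<Union>n. level2 n)" for \<gamma> :: bivertex
    by (cases \<gamma>) (auto simp: level2_def intro!: exI[of _ "max (length (fst \<gamma>)) (length (snd \<gamma>))"])
  then have "(\<Union>n. level2 n) = UNIV" by blast
  moreover have "incseq level2" by (auto simp: incseq_def level2_def)
  moreover have "finite (level2 n)" for n by (simp add: level2_def finite_length_le)
  ultimately show ?thesis using nn_integral_count_space_incseq[of level2 f] by simp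
qed

lemma ell2_norm_sq_real:
  assumes "\<And>a b. 0 \<le> f a b"
  shows "ell2_norm_sq (\<lambda>(a, b). ennreal (f a b)) =
    (SUP n. ennreal (\<Sum>a | length a \<le> n. \<Sum>b | length b \<le> n. (f a b)\<^sup>2))"
proof -
  have "(\<Sum>\<gamma>\<in>level2 n. (case \<gamma> of (a, b) \<Rightarrow> ennreal (f a b))\<^sup>2)
      = ennreal (\<Sum>a | length a \<le> n. \<Sum>b | length b \<le> n. (f a b)\<^sup>2)" for n
  proof -
    have "(\<Sum>\<gamma>\<in>level2 n. (case \<gamma> of (a, b) \<Rightarrow> ennreal (f a b))\<^sup>2)
        = (\<Sum>\<gamma>\<in>level2 n. ennreal (case \<gamma> of (a, b) \<Rightarrow> (f a b)\<^sup>2))"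
      by (intro sum.cong refl) (auto simp: assms ennreal_power)
    also have "\<dots> = ennreal (\<Sum>\<gamma>\<in>level2 n. case \<gamma> of (a, b) \<Rightarrow> (f a b)\<^sup>2)"
      by (rule sum_ennreal) auto
    also have "(\<Sum>\<gamma>\<in>level2 n. case \<gamma> of (a, b) \<Rightarrow> (f a b)\<^sup>2)
        = (\<Sum>a | length a \<le> n. \<Sum>b | length b \<le> n. (f a b)\<^sup>2)"
      unfolding level2_def by (rule sum.cartesian_product[symmetric])
    finally show ?thesis .
  qed
  then show ?thesis by (simp add: ell2_norm_sq_def nn_integral_bivertex)
qed

lemma vert2_le_vert2_iff:
  "vert2 (a, b) \<le> vert2 (u, v) \<longleftrightarrow> prefix u a \<and> prefix v b"
  by (simp add: vert2_def)

lemma potential_vertex: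
  assumes "\<And>\<gamma>. 0 \<le> f \<gamma>"
  shows "potential (\<lambda>\<gamma>. ennreal (f \<gamma>)) (vert2 (a, b)) = ennreal (bihardy (\<lambda>a b. f (a, b)) a b)"
proof -
  have "{\<gamma>. vert2 (a, b) \<le> vert2 \<gamma>} = {u. prefix u a} \<times> {v. prefix v b}"
    by (auto simp: vert2_le_vert2_iff)
  then show ?thesis
    unfolding potential_def bihardy_def sum.cartesian_product
    by (simp add: nn_integral_count_space_finite finite_prefixes assms case_prod_beta)
qed

lemma potential_antimono:
  assumes "\<alpha> \<le> \<beta>"
  shows "potential f \<beta> \<le> potential f \<alpha>"
  unfolding potential_def
  by (subst (1 2) nn_integral_count_space_indicator)
    (use assms order_trans in \<open>auto intro!: nn_integral_mono simp: indicator_def\<close>)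

text \<open>The potential at a boundary point is the limit of the potentials along the diagonal sequence of
  its ancestors. It may be infinite, whereas at a vertex it is a finite sum.\<close>

lemma potential_boundary_vertex:
  assumes "\<zeta> \<in> boundary2" and gt: "c < potential f \<zeta>"
  obtains a b where "\<zeta> \<le> vert2 (a, b)" "c < potential f (vert2 (a, b))"
proof -
  obtain x y where \<zeta>: "\<zeta> = (Bdry x, Bdry y)" using assms(1) by (auto simp: boundary2_def)
  define B where "B n = {\<gamma>. vert2 (ray_vertex x n, ray_vertex y n) \<le> vert2 \<gamma>}" for n
  have B: "B n = {u. \<exists>i\<le>n. u = ray_vertex x i} \<times> {v. \<exists>i\<le>n. v = ray_vertex y i}" for n
    by (auto simp: B_def vert2_le_vert2_iff prefix_ray_vertex_iff)
  have fin: "finite (B n)" for n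
    by (auto simp: B)
  have inc: "incseq B" unfolding incseq_def B by (blast intro: order_trans)
  have "{\<gamma>. \<zeta> \<le> vert2 \<gamma>} = (\<Union>n. B n)"
  proof (intro set_eqI iffI)
    fix \<gamma> assume "\<gamma> \<in> {\<gamma>. \<zeta> \<le> vert2 \<gamma>}"
    then obtain i j where "\<gamma> = (ray_vertex x i, ray_vertex y j)"
      by (cases \<gamma>) (auto simp: \<zeta> vert2_def)
    then have "\<gamma> \<in> B (max i j)" unfolding B using max.cobounded1 max.cobounded2 by blast
    then show "\<gamma> \<in> (\<Union>n. B n)" by blast
  next
    fix \<gamma> assume "\<gamma> \<in> (\<Union>n. B n)"
    then show "\<gamma> \<in> {\<gamma>. \<zeta> \<le> vert2 \<gamma>}" unfolding B by (auto simp: \<zeta> vert2_def)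
  qed
  then have "potential f \<zeta> = (SUP n. \<Sum>\<gamma>\<in>B n. f \<gamma>)"
    unfolding potential_def using nn_integral_count_space_incseq[OF inc fin] by simp
  then obtain n where "c < (\<Sum>\<gamma>\<in>B n. f \<gamma>)" using gt by (auto simp: less_SUP_iff)
  then have "c < potential f (vert2 (ray_vertex x n, ray_vertex y n))"
    using fin by (simp add: potential_def B_def nn_integral_count_space_finite)
  moreover have "\<zeta> \<le> vert2 (ray_vertex x n, ray_vertex y n)" by (auto simp: \<zeta> vert2_def)
  ultimately show ?thesis by (rule that[rotated])
qed


section \<open>Superadditivity of the masses of a measure\<close>

text \<open>The common ancestors of a point \<open>\<zeta>\<close> in the set and a point \<open>\<xi>\<close> outside it lie strictly above \<open>v\<close>,
  so there are at most \<open>length v\<close> of them, while \<open>\<zeta>\<close> alone has at least one ancestor more; this keeps their distance away from zero.\<close>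

lemma open_descendants: "open {\<zeta>. \<zeta> \<le> Vert v}"
  unfolding open_dist
proof (intro ballI)
  fix \<zeta> assume "\<zeta> \<in> {\<zeta>. \<zeta> \<le> Vert v}"
  then have v: "v \<in> ancestors \<zeta>" by (simp add: ancestors_def)
  have card: "card {u. prefix u v} = Suc (length v)"
    using distinct_card[OF distinct_prefixes[of v]] by (simp add: set_prefixes_eq)
  have "dist \<xi> \<zeta> \<ge> (1/2) ^ (length v + 2)" if out: "\<not> \<xi> \<le> Vert v" for \<xi>
  proof -
    have sub: "ancestors \<zeta> \<inter> ancestors \<xi> \<subseteq> {u. prefix u v} - {v}"
    proof
      fix u assume u: "u \<in> ancestors \<zeta> \<inter> ancestors \<xi>"
      have "v \<notin> ancestors \<xi>" using out by (simp add: ancestors_def)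
      then have "\<not> prefix v u" using u ancestors_prefix_closed by blast
      then show "u \<in> {u. prefix u v} - {v}" using u v ancestors_chain by blast
    qed
    then have "finite (ancestors \<zeta> \<inter> ancestors \<xi>)"
      by (rule finite_subset) (simp add: finite_prefixes)
    moreover have "card (ancestors \<zeta> \<inter> ancestors \<xi>) \<le> length v"
      using card_mono[OF _ sub] card by (simp add: finite_prefixes)
    ultimately have "meet_depth \<zeta> \<xi> \<le> enat (length v)" by (simp add: meet_depth_def)
    then have meet: "(1/2) ^ length v \<le> half_pow (meet_depth \<zeta> \<xi>)"
      using half_pow_antimono by fastforce
    have "{u. prefix u v} \<subseteq> ancestors \<zeta>" using v ancestors_prefix_closed by blast
    then have "enat (Suc (length v)) \<le> depth \<zeta>"
      using card_mono[of "ancestors \<zeta>" "{u. prefix u v}"] card by (auto simp: depth_def meet_depth_def)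
    then have dz: "half_pow (depth \<zeta>) \<le> (1/2) ^ Suc (length v)"
      using half_pow_antimono by fastforce
    have "half_pow (depth \<xi>) \<le> half_pow (meet_depth \<zeta> \<xi>)"
      by (intro half_pow_antimono meet_depth_le)
    moreover have "e / 4 \<le> m - 1/2 * (x + z)" if "x \<le> m" "e \<le> m" "z \<le> e / 2" for e m x z :: real
      using that by (simp add: field_simps)
    ultimately have "(1/2) ^ length v / 4
        \<le> half_pow (meet_depth \<zeta> \<xi>) - 1/2 * (half_pow (depth \<xi>) + half_pow (depth \<zeta>))"
      using meet dz by simp
    then show ?thesis
      by (simp add: dist_tbar_def meet_depth_commute[of \<xi>] power_add power2_eq_square)
  qed
  then show "\<exists>e>0. \<forall>\<xi>. dist \<xi> \<zeta> < e \<longrightarrow> \<xi> \<in> {\<zeta>. \<zeta> \<le> Vert v}"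
    by (intro exI[of _ "(1/2) ^ (length v + 2)"]) (auto simp: not_less[symmetric])
qed

lemma copotential_eq: "copotential \<mu> (a, b) = emeasure \<mu> ({\<zeta>. \<zeta> \<le> Vert a} \<times> {\<zeta>. \<zeta> \<le> Vert b})"
  unfolding copotential_def vert2_def by (rule arg_cong[where f = "emeasure \<mu>"]) auto

lemma descendants_children:
  "{\<zeta>. \<zeta> \<le> Vert (v @ [x])} \<subseteq> {\<zeta>. \<zeta> \<le> Vert v}"
  "{\<zeta>. \<zeta> \<le> Vert (v @ [False])} \<inter> {\<zeta>. \<zeta> \<le> Vert (v @ [True])} = {}"
proof -
  have "Vert (v @ [x]) \<le> Vert v" by simp
  then show "{\<zeta>. \<zeta> \<le> Vert (v @ [x])} \<subseteq> {\<zeta>. \<zeta> \<le> Vert v}" using order_trans by blast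
  show "{\<zeta>. \<zeta> \<le> Vert (v @ [False])} \<inter> {\<zeta>. \<zeta> \<le> Vert (v @ [True])} = {}"
    using ancestors_chain[of "v @ [False]" _ "v @ [True]"] by (auto simp: ancestors_def)
qed

lemma copotential_superadditive:
  assumes sets: "sets \<mu> = sets borel"
  shows "copotential \<mu> (v @ [False], b) + copotential \<mu> (v @ [True], b) \<le> copotential \<mu> (v, b)"
    and "copotential \<mu> (a, v @ [False]) + copotential \<mu> (a, v @ [True]) \<le> copotential \<mu> (a, v)"
proof -
  have [measurable]: "{\<zeta>. \<zeta> \<le> Vert a} \<times> {\<zeta>. \<zeta> \<le> Vert b} \<in> sets \<mu>" for a b
    unfolding sets by (intro borel_open open_Times open_descendants)
  note D = descendants_children
  have "emeasure \<mu> (P \<times> R) + emeasure \<mu> (Q \<times> R) \<le> emeasure \<mu> (S \<times> R)"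
    if "P \<times> R \<in> sets \<mu>" "Q \<times> R \<in> sets \<mu>" "S \<times> R \<in> sets \<mu>" "P \<inter> Q = {}" "P \<subseteq> S" "Q \<subseteq> S" for P Q R S
    using that by (subst plus_emeasure) (auto intro!: emeasure_mono)
  from this[OF _ _ _ D(2)[of v] D(1)[of v] D(1)[of v]]
  show "copotential \<mu> (v @ [False], b) + copotential \<mu> (v @ [True], b) \<le> copotential \<mu> (v, b)"
    by (simp add: copotential_eq)
  have "emeasure \<mu> (R \<times> P) + emeasure \<mu> (R \<times> Q) \<le> emeasure \<mu> (R \<times> S)"
    if "R \<times> P \<in> sets \<mu>" "R \<times> Q \<in> sets \<mu>" "R \<times> S \<in> sets \<mu>" "P \<inter> Q = {}" "P \<subseteq> S" "Q \<subseteq> S" for P Q R S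
    using that by (subst plus_emeasure) (auto intro!: emeasure_mono)
  from this[OF _ _ _ D(2)[of v] D(1)[of v] D(1)[of v]]
  show "copotential \<mu> (a, v @ [False]) + copotential \<mu> (a, v @ [True]) \<le> copotential \<mu> (a, v)"
    by (simp add: copotential_eq)
qed


section \<open>The extremal function\<close>

text \<open>Approximation in norm is pointwise approximation, with the same error at all vertices.\<close>

lemma abs_less_of_ell2_norm_sq:
  assumes "ell2_norm_sq (\<lambda>\<gamma>. ennreal \<bar>h \<gamma>\<bar>) < ennreal (\<epsilon>\<^sup>2)" "0 < \<epsilon>"
  shows "\<bar>h \<gamma>\<bar> < \<epsilon>"
proof -
  have "(ennreal \<bar>h \<gamma>\<bar>)\<^sup>2 \<le> ell2_norm_sq (\<lambda>\<gamma>. ennreal \<bar>h \<gamma>\<bar>)"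
    unfolding ell2_norm_sq_def by (rule nn_integral_ge_point) simp
  also note assms(1)
  finally have "\<bar>h \<gamma>\<bar>\<^sup>2 < \<epsilon>\<^sup>2" by (simp add: ennreal_power ennreal_less_iff)
  then show ?thesis using assms(2) by (simp add: power2_less_imp_less)
qed

lemma admissible_nonneg: "g \<in> admissible E \<Longrightarrow> 0 \<le> g \<gamma>"
  unfolding admissible_def by blast

lemma ell2_closure_nonneg:
  assumes f: "f \<in> ell2_closure (admissible E)"
  shows "0 \<le> f \<gamma>"
proof (rule ccontr)
  assume neg: "\<not> 0 \<le> f \<gamma>"
  then obtain g where g: "g \<in> admissible E"
    and "ell2_norm_sq (\<lambda>\<gamma>. ennreal \<bar>f \<gamma> - g \<gamma>\<bar>) < ennreal ((- f \<gamma>)\<^sup>2)"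
    using f unfolding ell2_closure_def by (auto dest!: spec[of _ "- f \<gamma>"])
  then have "\<bar>f \<gamma> - g \<gamma>\<bar> < - f \<gamma>"
    using abs_less_of_ell2_norm_sq[of "\<lambda>\<gamma>. f \<gamma> - g \<gamma>" "- f \<gamma>" \<gamma>] neg by simp
  moreover have "0 \<le> g \<gamma>" using g by (rule admissible_nonneg)
  ultimately show False by linarith
qed

text \<open>Points of \<open>E\<close> below the vertex \<open>(a, b)\<close> keep at least the potential of that vertex, which
  drops by exactly \<open>c\<close>; the potential at all other points does not involve the value at \<open>(a, b)\<close>.\<close>

lemma admissible_lower_at:
  assumes g: "g \<in> admissible E" and c: "0 \<le> c" "c \<le> g (a, b)"
    and big: "1 + c \<le> bihardy (\<lambda>a b. g (a, b)) a b"
  shows "g((a, b) := g (a, b) - c) \<in> admissible E"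
proof -
  let ?g' = "g((a, b) := g (a, b) - c)"
  have pos: "0 \<le> ?g' \<gamma>" for \<gamma> using admissible_nonneg[OF g] c by simp
  have "1 \<le> potential (\<lambda>\<gamma>. ennreal (?g' \<gamma>)) \<zeta>" if \<zeta>: "\<zeta> \<in> E" for \<zeta>
  proof (cases "\<zeta> \<le> vert2 (a, b)")
    case True
    have "bihardy (\<lambda>a b. g (a, b)) a b = bihardy (\<lambda>u v. ?g' (u, v)) a b + c"
    proof -
      have "bihardy (\<lambda>a b. g (a, b)) a b
          = bihardy (\<lambda>u v. ?g' (u, v) + (if u = a then if v = b then c else 0 else 0)) a b"
        unfolding bihardy_def by (intro sum.cong refl) auto
      also have "\<dots> = bihardy (\<lambda>u v. ?g' (u, v)) a b + c"
      proof -
        have "(\<Sum>v | prefix v b. if u = a then if v = b then c else 0 else 0)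
            = (if u = a then c else 0)" for u
          by (simp add: finite_prefixes)
        then show ?thesis
          unfolding bihardy_add by (simp add: bihardy_def finite_prefixes)
      qed
      finally show ?thesis .
    qed
    then have "1 \<le> potential (\<lambda>\<gamma>. ennreal (?g' \<gamma>)) (vert2 (a, b))"
      unfolding potential_vertex[of ?g', OF pos] using big by simp
    also have "\<dots> \<le> potential (\<lambda>\<gamma>. ennreal (?g' \<gamma>)) \<zeta>" by (rule potential_antimono[OF True])
    finally show ?thesis .
  next
    case False
    then have "potential (\<lambda>\<gamma>. ennreal (?g' \<gamma>)) \<zeta> = potential (\<lambda>\<gamma>. ennreal (g \<gamma>)) \<zeta>"
      unfolding potential_def by (intro nn_integral_cong) auto
    then show ?thesis using g \<zeta> by (simp add: admissible_def)
  qed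
  then show ?thesis using pos unfolding admissible_def by blast
qed

lemma ell2_norm_sq_lower_at_less:
  assumes fin: "ell2_norm_sq (\<lambda>\<gamma>. ennreal \<bar>f \<gamma>\<bar>) < \<infinity>" and c: "0 < c" "c \<le> f \<alpha>"
  shows "ell2_norm_sq (\<lambda>\<gamma>. ennreal \<bar>(f(\<alpha> := f \<alpha> - c)) \<gamma>\<bar>) < ell2_norm_sq (\<lambda>\<gamma>. ennreal \<bar>f \<gamma>\<bar>)"
proof -
  let ?f' = "f(\<alpha> := f \<alpha> - c)" and ?k = "(f \<alpha>)\<^sup>2 - (f \<alpha> - c)\<^sup>2"
  have k: "0 < ?k" using c by (simp add: power_strict_mono)
  have "(ennreal \<bar>f \<gamma>\<bar>)\<^sup>2 = (ennreal \<bar>?f' \<gamma>\<bar>)\<^sup>2 + ennreal ?k * indicator {\<alpha>} \<gamma>" for \<gamma>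
    using k by (auto simp: ennreal_power ennreal_plus[symmetric] simp del: ennreal_plus)
  then have eq: "ell2_norm_sq (\<lambda>\<gamma>. ennreal \<bar>f \<gamma>\<bar>)
      = ell2_norm_sq (\<lambda>\<gamma>. ennreal \<bar>?f' \<gamma>\<bar>) + ennreal ?k"
    unfolding ell2_norm_sq_def by (simp add: nn_integral_add nn_integral_cmult_indicator)
  then have "ell2_norm_sq (\<lambda>\<gamma>. ennreal \<bar>?f' \<gamma>\<bar>) < \<infinity>" using fin by auto
  then show ?thesis unfolding eq using k
    ennreal_add_left_cancel_less[of "ell2_norm_sq (\<lambda>\<gamma>. ennreal \<bar>?f' \<gamma>\<bar>)" 0 "ennreal ?k"] by simp
qed

text \<open>Otherwise \<open>f\<close> could be lowered at \<open>(a, b)\<close>. As \<open>f\<close> is only a limit of admissible functions, the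
  lowering is done on the approximations, which leaves their distance from \<open>f\<close> unchanged.\<close>

lemma extremal_potential_le_1:
  assumes ext: "extremal E f" and pos: "0 < f (a, b)"
  shows "bihardy (\<lambda>a b. f (a, b)) a b \<le> 1"
proof (rule ccontr)
  let ?F = "bihardy (\<lambda>a b. f (a, b)) a b"
  assume "\<not> ?F \<le> 1"
  \<comment> \<open>The available slack is \<open>d\<close>. Half of it is spent on lowering the function, the other half on the
    approximation, whose error enters the potential at \<open>(a, b)\<close> once for each of the \<open>N\<close> ancestors.\<close>
  define d where "d = min (f (a, b)) (?F - 1)"
  define N where "N = real (card {u. prefix u a} * card {v. prefix v b})"
  have d: "0 < d" using pos \<open>\<not> ?F \<le> 1\<close> by (simp add: d_def)
  have N: "1 \<le> N"
  proof -
    have "card {u. prefix u a} \<noteq> 0" "card {v. prefix v b} \<noteq> 0"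
      by (auto simp: finite_prefixes)
    then have "1 \<le> card {u. prefix u a} * card {v. prefix v b}" by (metis One_nat_def Suc_leI mult_pos_pos not_gr_zero)
    then show ?thesis unfolding N_def by linarith
  qed
  let ?f' = "f((a, b) := f (a, b) - d / 2)"
  have f: "f \<in> ell2_closure (admissible E)" using ext by (simp add: extremal_def)
  then have fin: "ell2_norm_sq (\<lambda>\<gamma>. ennreal \<bar>f \<gamma>\<bar>) < \<infinity>" by (simp add: ell2_closure_def)
  have less: "ell2_norm_sq (\<lambda>\<gamma>. ennreal \<bar>?f' \<gamma>\<bar>) < ell2_norm_sq (\<lambda>\<gamma>. ennreal \<bar>f \<gamma>\<bar>)"
    by (rule ell2_norm_sq_lower_at_less[OF fin]) (use d pos in \<open>auto simp: d_def\<close>)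
  have "?f' \<in> ell2_closure (admissible E)"
    unfolding ell2_closure_def
  proof (intro CollectI conjI allI impI)
    show "ell2_norm_sq (\<lambda>\<gamma>. ennreal \<bar>?f' \<gamma>\<bar>) < \<infinity>" using less fin by (rule less_trans)
    fix \<epsilon> :: real assume "0 < \<epsilon>"
    define \<tau> where "\<tau> = min \<epsilon> (d / (2 * N))"
    have \<tau>: "0 < \<tau>" using \<open>0 < \<epsilon>\<close> d N by (simp add: \<tau>_def)
    then obtain g where g: "g \<in> admissible E"
      and fg: "ell2_norm_sq (\<lambda>\<gamma>. ennreal \<bar>f \<gamma> - g \<gamma>\<bar>) < ennreal (\<tau>\<^sup>2)"
      using f unfolding ell2_closure_def by blast
    have close: "\<bar>f \<gamma> - g \<gamma>\<bar> < \<tau>" for \<gamma>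
      using abs_less_of_ell2_norm_sq[of "\<lambda>\<gamma>. f \<gamma> - g \<gamma>", OF fg \<tau>] .
    have N\<tau>: "N * \<tau> \<le> d / 2"
    proof -
      have "\<tau> \<le> d / (2 * N)" by (simp add: \<tau>_def)
      then show ?thesis using N by (simp add: field_simps)
    qed
    have "\<tau> \<le> N * \<tau>" using N \<tau> by simp
    then have "d / 2 \<le> g (a, b)"
      using close[of "(a, b)"] N\<tau> by (auto simp: d_def)
    moreover have "1 + d / 2 \<le> bihardy (\<lambda>a b. g (a, b)) a b"
    proof -
      have "?F \<le> bihardy (\<lambda>u v. g (u, v) + \<tau>) a b"
        by (rule bihardy_mono) (use close in \<open>smt (verit)\<close>)
      also have "\<dots> = bihardy (\<lambda>u v. g (u, v)) a b + N * \<tau>"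
        unfolding bihardy_add by (simp add: bihardy_def N_def)
      finally have "?F \<le> bihardy (\<lambda>a b. g (a, b)) a b + N * \<tau>" .
      moreover have "d \<le> ?F - 1" by (simp add: d_def)
      ultimately show ?thesis using N\<tau> by linarith
    qed
    ultimately have "g((a, b) := g (a, b) - d / 2) \<in> admissible E"
      using d by (intro admissible_lower_at[OF g]) auto
    moreover have "ell2_norm_sq (\<lambda>\<gamma>. ennreal \<bar>?f' \<gamma> - (g((a, b) := g (a, b) - d / 2)) \<gamma>\<bar>) < ennreal (\<epsilon>\<^sup>2)"
    proof -
      have "(\<lambda>\<gamma>. ennreal \<bar>?f' \<gamma> - (g((a, b) := g (a, b) - d / 2)) \<gamma>\<bar>) = (\<lambda>\<gamma>. ennreal \<bar>f \<gamma> - g \<gamma>\<bar>)"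
        by auto
      moreover have "\<tau>\<^sup>2 \<le> \<epsilon>\<^sup>2" using \<tau> by (intro power_mono) (auto simp: \<tau>_def)
      ultimately show ?thesis using fg by (metis ennreal_leI order_less_le_trans)
    qed
    ultimately show "\<exists>g\<in>admissible E. ell2_norm_sq (\<lambda>\<gamma>. ennreal \<bar>?f' \<gamma> - g \<gamma>\<bar>) < ennreal (\<epsilon>\<^sup>2)"
      by blast
  qed
  then show False using ext less by (auto simp: extremal_def not_le[symmetric])
qed


section \<open>The capacitary estimate\<close>

lemma ell2_norm_sq_add_mixed_le:
  assumes f: "\<And>a b. 0 \<le> f a b"
    and sup: "\<And>b. superadditive (\<lambda>a. f a b)" "\<And>a. superadditive (f a)"
    and bd: "\<And>a b. f a b > 0 \<Longrightarrow> bihardy f a b \<le> 1" and c: "0 \<le> c"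
  shows "ell2_norm_sq (\<lambda>(a, b). ennreal (c * (f a b + mixed f a b)))
    \<le> ennreal (10 * c\<^sup>2) * ell2_norm_sq (\<lambda>(a, b). ennreal (f a b))"
proof -
  note mixed = mixed_nonneg[of f, OF f]
  let ?S = "\<lambda>n h. \<Sum>a | length a \<le> n. \<Sum>b | length b \<le> n. (h a b)\<^sup>2"
  have "?S n (\<lambda>a b. c * (f a b + mixed f a b)) \<le> 10 * c\<^sup>2 * ?S n f" for n :: nat
  proof -
    have "(c * (f a b + mixed f a b))\<^sup>2 \<le> 2 * c\<^sup>2 * (f a b)\<^sup>2 + 2 * c\<^sup>2 * (mixed f a b)\<^sup>2" for a b
    proof -
      have "(f a b + mixed f a b)\<^sup>2 \<le> 2 * (f a b)\<^sup>2 + 2 * (mixed f a b)\<^sup>2"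
        using sum_squares_bound[of "f a b" "mixed f a b"] by (simp add: power2_sum)
      then have "c\<^sup>2 * (f a b + mixed f a b)\<^sup>2 \<le> c\<^sup>2 * (2 * (f a b)\<^sup>2 + 2 * (mixed f a b)\<^sup>2)"
        by (rule mult_left_mono) simp
      then show ?thesis unfolding power_mult_distrib by (simp add: algebra_simps)
    qed
    then have "?S n (\<lambda>a b. c * (f a b + mixed f a b))
        \<le> (\<Sum>a | length a \<le> n. \<Sum>b | length b \<le> n.
              2 * c\<^sup>2 * (f a b)\<^sup>2 + 2 * c\<^sup>2 * (mixed f a b)\<^sup>2)"
      by (intro sum_mono)
    also have "\<dots> = 2 * c\<^sup>2 * ?S n f + 2 * c\<^sup>2 * ?S n (mixed f)"
      by (simp add: sum.distrib sum_distrib_left)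
    also have "\<dots> \<le> 2 * c\<^sup>2 * ?S n f + 2 * c\<^sup>2 * (4 * ?S n f)"
      using sum_mixed_power2_le[of f 1 n, OF f sup bd] by (intro add_left_mono mult_left_mono) auto
    finally show ?thesis by simp
  qed
  then have "ennreal (?S n (\<lambda>a b. c * (f a b + mixed f a b)))
      \<le> ennreal (10 * c\<^sup>2) * ennreal (?S n f)" for n
    by (simp add: ennreal_mult'[symmetric] ennreal_leI)
  then show ?thesis
    using f mixed c
    by (subst (1 2) ell2_norm_sq_real)
      (auto simp: SUP_mult_left_ennreal intro!: SUP_mono')
qed

text \<open>The constant is \<open>10 * 2\<^sup>2\<close>: the factor \<open>2 / lam\<^sup>2\<close> of the test function enters squared, and the
  squared norm of \<open>f + mixed f\<close> is at most \<open>2 * (1 + 4)\<close> times that of \<open>f\<close>.\<close>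

lemma cap_superlevel_le:
  assumes f: "\<And>a b. 0 \<le> f a b"
    and sup: "\<And>b. superadditive (\<lambda>a. f a b)" "\<And>a. superadditive (f a)"
    and bd: "\<And>a b. f a b > 0 \<Longrightarrow> bihardy f a b \<le> 1" and lam: "0 < lam"
  shows "cap {\<zeta> \<in> boundary2. potential (\<lambda>(a, b). ennreal (f a b)) \<zeta> > ennreal lam}
    \<le> ennreal (40 / lam ^ 4) * ell2_norm_sq (\<lambda>(a, b). ennreal (f a b))"
proof -
  define \<phi> where "\<phi> = (\<lambda>(a, b). 2 / lam\<^sup>2 * (f a b + mixed f a b))"
  note mixed = mixed_nonneg[of f, OF f]
  have pos: "0 \<le> \<phi> \<gamma>" for \<gamma>
    using f mixed by (auto simp: \<phi>_def split: prod.split)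
  have "1 \<le> potential (\<lambda>\<gamma>. ennreal (\<phi> \<gamma>)) \<zeta>"
    if \<zeta>: "\<zeta> \<in> boundary2" "potential (\<lambda>(a, b). ennreal (f a b)) \<zeta> > ennreal lam" for \<zeta>
  proof -
    obtain a b where le: "\<zeta> \<le> vert2 (a, b)"
      and "ennreal lam < potential (\<lambda>(a, b). ennreal (f a b)) (vert2 (a, b))"
      by (rule potential_boundary_vertex[OF \<zeta>])
    then have "lam < bihardy f a b"
      using potential_vertex[of "\<lambda>(a, b). f a b" a b] f lam
      by (simp add: split_def ennreal_less_iff)
    then have "lam\<^sup>2 \<le> (bihardy f a b)\<^sup>2" using lam by (intro power_mono) auto
    also have "\<dots> \<le> 2 * bihardy (\<lambda>a b. f a b * bihardy f a b + mixed f a b) a b"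
      by (rule bihardy_power2_le[OF f])
    also have "\<dots> \<le> 2 * bihardy (\<lambda>a b. f a b + mixed f a b) a b"
    proof (intro mult_left_mono bihardy_mono add_right_mono)
      show "f a b * bihardy f a b \<le> f a b" for a b
        using f[of a b] bd[of a b] by (cases "f a b = 0") (auto intro: mult_left_le)
    qed simp
    finally have "1 \<le> 2 / lam\<^sup>2 * bihardy (\<lambda>a b. f a b + mixed f a b) a b"
      using lam by (simp add: field_simps)
    also have "\<dots> = bihardy (\<lambda>a b. \<phi> (a, b)) a b"
      by (simp only: bihardy_cmult[symmetric] \<phi>_def prod.case)
    finally have "1 \<le> potential (\<lambda>\<gamma>. ennreal (\<phi> \<gamma>)) (vert2 (a, b))"
      by (simp add: potential_vertex pos)
    then show ?thesis using potential_antimono[OF le] order_trans by blast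
  qed
  then have "\<phi> \<in> admissible {\<zeta> \<in> boundary2. potential (\<lambda>(a, b). ennreal (f a b)) \<zeta> > ennreal lam}"
    using pos by (auto simp: admissible_def)
  then have "cap {\<zeta> \<in> boundary2. potential (\<lambda>(a, b). ennreal (f a b)) \<zeta> > ennreal lam}
      \<le> ell2_norm_sq (\<lambda>\<gamma>. ennreal (\<phi> \<gamma>))"
    unfolding cap_def by (rule INF_lower)
  also have "(\<lambda>\<gamma>. ennreal (\<phi> \<gamma>)) = (\<lambda>(a, b). ennreal (2 / lam\<^sup>2 * (f a b + mixed f a b)))"
    by (auto simp: \<phi>_def)
  also have "ell2_norm_sq \<dots>
      \<le> ennreal (10 * (2 / lam\<^sup>2)\<^sup>2) * ell2_norm_sq (\<lambda>(a, b). ennreal (f a b))"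
    by (rule ell2_norm_sq_add_mixed_le[OF f sup bd]) simp_all
  also have "10 * (2 / lam\<^sup>2)\<^sup>2 = 40 / lam ^ 4" by (simp add: power_divide)
  finally show ?thesis .
qed

theorem theorem1p6:
  shows "\<exists>C::real. C > 0 \<and>
    (\<forall>(E :: bitbar set) (\<mu> :: bitbar measure) (lam :: real).
      E \<in> sets borel \<and> E \<subseteq> boundary2 \<and> equilibrium_measure E \<mu> \<and> 1 \<le> lam \<longrightarrow>
      cap {\<zeta> \<in> boundary2. V_potential \<mu> \<zeta> > ennreal lam}
        \<le> ennreal C * ell2_norm_sq (copotential \<mu>) / ennreal (lam ^ 3))"
proof (intro exI[of _ 40] conjI allI impI)
  fix E :: "bitbar set" and \<mu> :: "bitbar measure" and lam :: real
  assume hyp: "E \<in> sets borel \<and> E \<subseteq> boundary2 \<and> equilibrium_measure E \<mu> \<and> 1 \<le> lam"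
  then have lam: "1 \<le> lam" and sets: "sets \<mu> = sets borel"
    by (auto simp: equilibrium_measure_def)
  obtain f where ext: "extremal E f" and f: "copotential \<mu> \<beta> = ennreal (f \<beta>)" for \<beta>
    using hyp by (auto simp: equilibrium_measure_def)
  have pos: "0 \<le> f \<beta>" for \<beta> using ext ell2_closure_nonneg[of f E] by (simp add: extremal_def)
  have sup: "superadditive (\<lambda>a. f (a, b))" "superadditive (\<lambda>b. f (a, b))" for a b
    using copotential_superadditive[OF sets] pos
    by (simp_all add: superadditive_def f ennreal_plus[symmetric] ennreal_le_iff del: ennreal_plus)
  have cop: "copotential \<mu> = (\<lambda>(a, b). ennreal (f (a, b)))" by (auto simp: f)
  have "cap {\<zeta> \<in> boundary2. V_potential \<mu> \<zeta> > ennreal lam}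
      \<le> ennreal (40 / lam ^ 4) * ell2_norm_sq (copotential \<mu>)"
    unfolding V_potential_def cop
    by (rule cap_superlevel_le) (use pos sup extremal_potential_le_1[OF ext] lam in auto)
  also have "\<dots> \<le> ennreal (40 / lam ^ 3) * ell2_norm_sq (copotential \<mu>)"
  proof (intro mult_right_mono ennreal_leI divide_left_mono)
    show "lam ^ 3 \<le> lam ^ 4" using lam by (intro power_increasing) auto
  qed (use lam in auto)
  also have "\<dots> = ennreal 40 * ell2_norm_sq (copotential \<mu>) / ennreal (lam ^ 3)"
    using lam by (simp add: divide_ennreal[symmetric] ennreal_times_divide mult.commute)
  finally show "cap {\<zeta> \<in> boundary2. V_potential \<mu> \<zeta> > ennreal lam}
      \<le> ennreal 40 * ell2_norm_sq (copotential \<mu>) / ennreal (lam ^ 3)" .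
qed simp

end
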